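(* Let $A\in\mathbb{R}^{n\times n}$, $C\in\mathbb{R}^{q\times n}$, $F\in\mathbb{R}^{r\times n}$. If $(A,C,F)$ is functionally observable, then applying any sampling scheme $\{t_i\}_{i=1}^k$ such that $$\operatorname{rank}\big(O_{\mathrm s}(A_{\mathrm{ob}},C_{\mathrm{ob}})\big)=n-p$$ guarantees sample-based functional observability of $(A,C,F)$ (for that sampling scheme). (The statement holds both in the continuous-time and in the discrete-time setting, with the corresponding sample-based observability matrix $O_{\mathrm s}$.)
   Context: System: $x^+=Ax(t)+Bu(t)$, $y(t)=Cx(t)+Du(t)$, $z(t)=Fx(t)$ with $A\in\mathbb{R}^{n\times n}$, $B\in\mathbb{R}^{n\times m}$, $C\in\mathbb{R}^{q\times n}$, $D\in\mathbb{R}^{q\times m}$, $F\in\mathbb{R}^{r\times n}$, where $x^+$ denotes $\dot x(t)$ for continuous-time systems and $x(t+1)$ for discrete-time systems. Observability matrix: for $M\in\mathbb{R}^{n\times n}$ and $N$ with $n$ columns, $O(M,N)$ is the matrix obtained by stacking $N, NM, NM^2,\dots,NM^{n-1}$ vertically. Sampling scheme: time instances $\{t_i\}_{i=1}^k$, $k\ge 1$, with $0\le t_1$ and $t_i<t_{i+1}$ for $i=1,\dots,k-1$ (real numbers in continuous time, integers in discrete time). Sample-based observability matrix: for a pair $(M,N)$, $O_{\mathrm s}(M,N)$ is the matrix obtained by stacking vertically $Ne^{Mt_1},\dots,Ne^{Mt_k}$ in the continuous-time case, and $NM^{t_1},\dots,NM^{t_k}$ in the discrete-time case. Observable subsystem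 of $(A,C)$: let $p$ be the dimension of the unobservable subspace $\operatorname{null}(O(A,C))$. There is an invertible $P_{\mathrm o}\in\mathbb{R}^{n\times n}$ with $$P_{\mathrm o}^{-1}AP_{\mathrm o}=\begin{pmatrix}A_{\mathrm{ob}}&0\\ A_{21}&A_{\overline{\mathrm{ob}}}\end{pmatrix},\qquad CP_{\mathrm o}=\begin{pmatrix}C_{\mathrm{ob}}&0\end{pmatrix},$$ where $A_{\mathrm{ob}}\in\mathbb{R}^{(n-p)\times(n-p)}$, $C_{\mathrm{ob}}\in\mathbb{R}^{q\times(n-p)}$ and $(A_{\mathrm{ob}},C_{\mathrm{ob}})$ is observable. Functional observability: $(A,C,F)$ is functionally observable if for any initial state $x_0$ and input $u(t)$ there exists a finite time $\bar t$ such that the value of $Fx_0$ can be uniquely reconstructed from the outputs $y(t)$ and inputs $u(t)$, $0\le t\le\bar t$. A known equivalent characterization is $\operatorname{rank}\begin{pmatrix}O(A,C)\\ O(A,F)\end{pmatrix}=\operatorname{rank}(O(A,C))$, equivalently $\operatorname{rank}\begin{pmatrix}O(A,C)\\ F\end{pmatrix}=\operatorname{rank}(O(A,C))$. Observable subsystem of $(A,F)$ and the constant $\sigma$: let $p_F$ be the dimension of $\operatorname{null}(O(A,F))$. There is an invertible $P_{\mathrm{o,F}}\in\mathbb{R}^{n\times n}$ with $$P_{\mathrm{o,F}}^{-1}AP_{\mathrm{o,F}}=\begin{pmatrix}A_{\mathrm{ob,F}}&0\\ A_{21,\mathrm F}&A_{\overline{\mathrm{ob}},\mathrm F}\end{pmatrix},\qquad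 FP_{\mathrm{o,F}}=\begin{pmatrix}F_{\mathrm{ob}}&0\end{pmatrix},$$ where $(A_{\mathrm{ob,F}},F_{\mathrm{ob}})$ is observable of order $n-p_F$. Let $\nu$ be the observability index of $(A_{\mathrm{ob,F}},F_{\mathrm{ob}})$, i.e. the smallest integer such that the matrix obtained by stacking $F_{\mathrm{ob}},F_{\mathrm{ob}}A_{\mathrm{ob,F}},\dots,F_{\mathrm{ob}}A_{\mathrm{ob,F}}^{\nu-1}$ has rank $n-p_F$. Set $\sigma=0$ if the system is continuous-time and $\sigma=\nu-2$ if it is discrete-time. Sample-based functional observability: $(A,C,F)$ is sample-based functionally observable for the sampling sequence $\{t_i\}_{i=1}^k$ if there exists a finite time $\bar t>\sigma$ such that for any initial state $x_0$ and input $u(t)$, the value of $Fx(t)$, $0\le t\le\bar t$, can be uniquely reconstructed from the knowledge of the input trajectory on the interval $[0,\bar t]$ and the sampled outputs $y(t_i)$, $i=1,\dots,k$. (In discrete time, times are integers.) *)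

theory Defs
  imports "HOL-Analysis.Equivalence_Lebesgue_Henstock_Integration"
    "Jordan_Normal_Form.Matrix_Kernel"
    "Jordan_Normal_Form.DL_Rank"
begin

unbundle no vec_syntax
hide_type (open) Finite_Cartesian_Product.vec
hide_const (open) Finite_Cartesian_Product.vec Finite_Cartesian_Product.mat

abbreviation mat_rank :: "real mat \<Rightarrow> nat" where
  "mat_rank M \<equiv> vec_space.rank (dim_row M) M"

definition vstack :: "nat \<Rightarrow> real mat list \<Rightarrow> real mat" where
  "vstack nc Ms = mat_of_rows nc (concat (map rows Ms))"

text \<open>Entrywise power series; the matrices here have no fixed dimension, so they carry no
  norm and the library exponential does not apply.\<close>

definition mat_exp :: "real mat \<Rightarrow> real mat" where
  "mat_exp M = mat (dim_row M) (dim_row M) (\<lambda>(i, j). \<Sum>k. (M ^\<^sub>m k) $$ (i, j) / fact k)"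


section \<open>Observability matrices\<close>

definition obs_mat_upto :: "real mat \<Rightarrow> real mat \<Rightarrow> nat \<Rightarrow> real mat" where
  "obs_mat_upto M N l = vstack (dim_row M) (map (\<lambda>k. N * M ^\<^sub>m k) [0..<l])"

definition obs_mat :: "real mat \<Rightarrow> real mat \<Rightarrow> real mat" where
  "obs_mat M N = obs_mat_upto M N (dim_row M)"

definition observable :: "real mat \<Rightarrow> real mat \<Rightarrow> bool" where
  "observable M N \<longleftrightarrow> mat_rank (obs_mat M N) = dim_row M"

definition observability_index :: "real mat \<Rightarrow> real mat \<Rightarrow> nat" where
  "observability_index M N = (LEAST l. mat_rank (obs_mat_upto M N l) = dim_row M)"

text \<open>\<open>Q\<close> is the inverse of \<open>P\<close>. The second block equation is \<open>C P = (C1 0)\<close>; its lower blocks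
  have no rows.\<close>

definition observable_decomposition ::
  "real mat \<Rightarrow> real mat \<Rightarrow> real mat \<Rightarrow> real mat \<Rightarrow> real mat \<Rightarrow> real mat \<Rightarrow> real mat \<Rightarrow> bool" where
  "observable_decomposition A C P A11 A21 A22 C1 \<longleftrightarrow>
    (let n = dim_row A; q = dim_row C; p = kernel_dim (obs_mat A C) in
      P \<in> carrier_mat n n \<and>
      A11 \<in> carrier_mat (n - p) (n - p) \<and> A21 \<in> carrier_mat p (n - p) \<and>
      A22 \<in> carrier_mat p p \<and> C1 \<in> carrier_mat q (n - p) \<and>
      (\<exists>Q \<in> carrier_mat n n. P * Q = 1\<^sub>m n \<and> Q * P = 1\<^sub>m n \<and>
        Q * A * P = four_block_mat A11 (0\<^sub>m (n - p) p) A21 A22) \<and>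
      C * P = four_block_mat C1 (0\<^sub>m q p) (0\<^sub>m 0 (n - p)) (0\<^sub>m 0 p) \<and>
      observable A11 C1)"


section \<open>Sampling\<close>

definition sampling_scheme :: "'t::linordered_idom list \<Rightarrow> bool" where
  "sampling_scheme ts \<longleftrightarrow> ts \<noteq> [] \<and> sorted_wrt (<) ts \<and> (\<forall>t\<in>set ts. 0 \<le> t)"

definition sampled_obs_mat_ct :: "real mat \<Rightarrow> real mat \<Rightarrow> real list \<Rightarrow> real mat" where
  "sampled_obs_mat_ct M N ts = vstack (dim_row M) (map (\<lambda>t. N * mat_exp (t \<cdot>\<^sub>m M)) ts)"

definition sampled_obs_mat_dt :: "real mat \<Rightarrow> real mat \<Rightarrow> int list \<Rightarrow> real mat" where
  "sampled_obs_mat_dt M N ts = vstack (dim_row M) (map (\<lambda>t. N * M ^\<^sub>m nat t) ts)"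


section \<open>Trajectories\<close>

text \<open>Signals are functions on all of \<open>real\<close> or \<open>int\<close>; only their values at times \<open>t \<ge> 0\<close> matter.

  Continuous time: the input is locally integrable and \<open>dx/dt = A x + B u\<close> is understood in
  the sense of Caratheodory, i.e. in integrated form. This admits discontinuous inputs, and
  for continuous \<open>u\<close> it is the classical differential equation.\<close>

definition ct_trajectory ::
  "real mat \<Rightarrow> real mat \<Rightarrow> (real \<Rightarrow> real vec) \<Rightarrow> (real \<Rightarrow> real vec) \<Rightarrow> bool" where
  "ct_trajectory A B u x \<longleftrightarrow>
    (\<forall>t\<ge>0. x t \<in> carrier_vec (dim_row A) \<and> u t \<in> carrier_vec (dim_col B)) \<and>
    (\<forall>j<dim_col B. \<forall>t\<ge>0. (\<lambda>s. u s $ j) absolutely_integrable_on {0..t}) \<and>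
    (\<forall>i<dim_row A. \<forall>t\<ge>0.
      ((\<lambda>s. (A *\<^sub>v x s + B *\<^sub>v u s) $ i) has_integral (x t $ i - x 0 $ i)) {0..t})"

definition dt_trajectory ::
  "real mat \<Rightarrow> real mat \<Rightarrow> (int \<Rightarrow> real vec) \<Rightarrow> (int \<Rightarrow> real vec) \<Rightarrow> bool" where
  "dt_trajectory A B u x \<longleftrightarrow>
    (\<forall>t\<ge>0. x t \<in> carrier_vec (dim_row A) \<and> u t \<in> carrier_vec (dim_col B)) \<and>
    (\<forall>t\<ge>0. x (t + 1) = A *\<^sub>v x t + B *\<^sub>v u t)"


section \<open>Functional observability\<close>

text \<open>In the following two definitions \<open>Traj u x\<close> says that \<open>x\<close> is a state trajectory for the
  input \<open>u\<close>. A quantity can be uniquely reconstructed from given data iff any two trajectories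
  with the same data have the same value of that quantity. An initial state and an input
  determine the trajectory, so quantifying over pairs \<open>(u, x)\<close> with \<open>Traj u x\<close> amounts to
  quantifying over initial states \<open>x 0\<close> and inputs \<open>u\<close>.\<close>

definition functionally_observable ::
  "(('t::linordered_idom \<Rightarrow> real vec) \<Rightarrow> ('t \<Rightarrow> real vec) \<Rightarrow> bool) \<Rightarrow>
    real mat \<Rightarrow> real mat \<Rightarrow> real mat \<Rightarrow> bool" where
  "functionally_observable Traj C D F \<longleftrightarrow>
    (\<forall>u x. Traj u x \<longrightarrow>
      (\<exists>tb\<ge>0. \<forall>u' x'. Traj u' x' \<longrightarrow>
        (\<forall>t\<in>{0..tb}. u' t = u t) \<longrightarrow>
        (\<forall>t\<in>{0..tb}. C *\<^sub>v x' t + D *\<^sub>v u' t = C *\<^sub>v x t + D *\<^sub>v u t) \<longrightarrow>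
        F *\<^sub>v x' 0 = F *\<^sub>v x 0))"

text \<open>\<open>\<sigma>\<close> may be negative in discrete time, hence the separate condition \<open>0 \<le> tb\<close>.\<close>

definition sample_based_functionally_observable ::
  "(('t::linordered_idom \<Rightarrow> real vec) \<Rightarrow> ('t \<Rightarrow> real vec) \<Rightarrow> bool) \<Rightarrow>
    real mat \<Rightarrow> real mat \<Rightarrow> real mat \<Rightarrow> 't \<Rightarrow> 't list \<Rightarrow> bool" where
  "sample_based_functionally_observable Traj C D F \<sigma> ts \<longleftrightarrow>
    (\<exists>tb. 0 \<le> tb \<and> \<sigma> < tb \<and>
      (\<forall>u x u' x'. Traj u x \<longrightarrow> Traj u' x' \<longrightarrow>
        (\<forall>t\<in>{0..tb}. u' t = u t) \<longrightarrow>
        (\<forall>t\<in>set ts. C *\<^sub>v x' t + D *\<^sub>v u' t = C *\<^sub>v x t + D *\<^sub>v u t) \<longrightarrow>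
        (\<forall>t\<in>{0..tb}. F *\<^sub>v x' t = F *\<^sub>v x t)))"

end

theory Submission
  imports Defs
begin

text \<open>The difference of two trajectories with the same input solves the autonomous system. In
  the coordinates of the observable decomposition its observable part evolves autonomously as
  well, so that the sampled outputs are the sampled observability matrix applied to its initial
  value; full column rank forces that value, and hence the whole observable part, to vanish.
  The difference therefore stays in the unobservable subspace. Functional observability makes
  \<open>F\<close> vanish there, because an unobservable initial state with zero input has zero output.\<close>

section \<open>The observable decomposition\<close>

text \<open>With projection and embedding as matrices, the block structure becomes a set of matrix
  identities, which can be multiplied by the change of basis directly.\<close>

definition first_coords :: "nat \<Rightarrow> nat \<Rightarrow> real mat" where
  "first_coords n1 n2 = mat n1 (n1 + n2) (\<lambda>(i, j). if i = j then 1 else 0)"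

definition last_embed :: "nat \<Rightarrow> nat \<Rightarrow> real mat" where
  "last_embed n1 n2 = mat (n1 + n2) n2 (\<lambda>(i, j). if i = n1 + j then 1 else 0)"

lemma first_coords_carrier [simp]: "first_coords n1 n2 \<in> carrier_mat n1 (n1 + n2)"
  and last_embed_carrier [simp]: "last_embed n1 n2 \<in> carrier_mat (n1 + n2) n2"
  by (auto simp: first_coords_def last_embed_def)

lemma first_coords_mult:
  "X \<in> carrier_mat (n1 + n2) k \<Longrightarrow> first_coords n1 n2 * X = mat n1 k (\<lambda>ij. X $$ ij)"
  by (auto intro!: eq_matI simp: first_coords_def scalar_prod_def if_distrib[of "\<lambda>x. x * _"]
    cong: if_cong)

lemma mult_first_coords:
  "X \<in> carrier_mat k n1 \<Longrightarrow>
    X * first_coords n1 n2 = four_block_mat X (0\<^sub>m k n2) (0\<^sub>m 0 n1) (0\<^sub>m 0 n2)"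
  by (auto intro!: eq_matI simp: first_coords_def scalar_prod_def if_distrib[of "\<lambda>x. _ * x"]
    cong: if_cong)

lemma mult_last_embed:
  "X \<in> carrier_mat k (n1 + n2) \<Longrightarrow>
    X * last_embed n1 n2 = mat k n2 (\<lambda>(i, j). X $$ (i, n1 + j))"
  by (auto intro!: eq_matI simp: last_embed_def scalar_prod_def if_distrib[of "\<lambda>x. _ * x"]
    cong: if_cong)

lemma last_embed_mult:
  assumes "X \<in> carrier_mat n2 k"
  shows "last_embed n1 n2 * X =
    mat (n1 + n2) k (\<lambda>(i, j). if i < n1 then 0 else X $$ (i - n1, j))"
proof (rule eq_matI, goal_cases)
  case (1 i j)
  \<comment> \<open>The delta rule for sums needs a condition that compares the summation index
    alone; since \<open>i\<close> is at least \<open>n1\<close>, the truncated subtraction is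
    harmless.\<close>
  have "(if i = n1 + l then 1 else 0) = (if i - n1 = l then 1 else 0 :: real)" if "\<not> i < n1" for l
    using that by auto
  with assms 1 show ?case
    by (cases "i < n1")
      (auto simp: last_embed_def scalar_prod_def if_distrib[of "\<lambda>x. x * _"] cong: if_cong)
qed (use assms in \<open>auto simp: last_embed_def\<close>)

text \<open>The zero upper right block means that the first \<open>n1\<close> coordinates evolve on
  their own and that the last \<open>n2\<close> span an invariant subspace, on which the matrix acts
  as \<open>A22\<close>. The output matrix ignores that subspace.\<close>

lemma lower_block_intertwine:
  assumes "A11 \<in> carrier_mat n1 n1" "A21 \<in> carrier_mat n2 n1"
    and "A22 \<in> carrier_mat n2 n2" "C1 \<in> carrier_mat q n1"
  shows "first_coords n1 n2 * four_block_mat A11 (0\<^sub>m n1 n2) A21 A22 = A11 * first_coords n1 n2"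
    and "four_block_mat A11 (0\<^sub>m n1 n2) A21 A22 * last_embed n1 n2 = last_embed n1 n2 * A22"
    and "four_block_mat C1 (0\<^sub>m q n2) (0\<^sub>m 0 n1) (0\<^sub>m 0 n2) * last_embed n1 n2 = 0\<^sub>m q n2"
proof -
  let ?X = "four_block_mat A11 (0\<^sub>m n1 n2) A21 A22"
  let ?Y = "four_block_mat C1 (0\<^sub>m q n2) (0\<^sub>m 0 n1) (0\<^sub>m 0 n2)"
  have X: "?X \<in> carrier_mat (n1 + n2) (n1 + n2)" using assms by simp
  have Y: "?Y \<in> carrier_mat q (n1 + n2)"
    using assms four_block_carrier_mat[of C1 q n1 "0\<^sub>m 0 n2" 0 n2] by simp
  show "first_coords n1 n2 * ?X = A11 * first_coords n1 n2"
    unfolding first_coords_mult[OF X] mult_first_coords[OF assms(1)]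
    using assms by (auto intro!: eq_matI)
  show "?X * last_embed n1 n2 = last_embed n1 n2 * A22"
    unfolding mult_last_embed[OF X] last_embed_mult[OF assms(3)]
    using assms by (auto intro!: eq_matI)
  show "?Y * last_embed n1 n2 = 0\<^sub>m q n2"
    unfolding mult_last_embed[OF Y] using assms by (auto intro!: eq_matI)
qed

text \<open>\<open>R\<close> maps a state to the state of the observable subsystem, and \<open>S\<close> embeds the
  unobservable subspace.\<close>

lemma observable_decompositionE:
  fixes A C :: "real mat"
  assumes A: "A \<in> carrier_mat n n" and C: "C \<in> carrier_mat q n"
    and dec: "observable_decomposition A C P A11 A21 A22 C1"
  obtains n1 n2 R S where
    "n1 = n - kernel_dim (obs_mat A C)"
    "A11 \<in> carrier_mat n1 n1" "A22 \<in> carrier_mat n2 n2" "C1 \<in> carrier_mat q n1"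
    "R \<in> carrier_mat n1 n" "S \<in> carrier_mat n n2"
    "R * A = A11 * R" "C = C1 * R" "A * S = S * A22" "C * S = 0\<^sub>m q n2"
    "\<And>v. v \<in> carrier_vec n \<Longrightarrow> R *\<^sub>v v = 0\<^sub>v n1 \<Longrightarrow> \<exists>z\<in>carrier_vec n2. v = S *\<^sub>v z"
proof -
  define n2 where "n2 = kernel_dim (obs_mat A C)"
  define n1 where "n1 = n - n2"
  note dec = dec[unfolded observable_decomposition_def Let_def carrier_matD(1)[OF A]
      carrier_matD(1)[OF C], folded n2_def, folded n1_def]
  from dec obtain Q where
    P: "P \<in> carrier_mat n n" and Q: "Q \<in> carrier_mat n n" and
    A11: "A11 \<in> carrier_mat n1 n1" and A21: "A21 \<in> carrier_mat n2 n1" and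
    A22: "A22 \<in> carrier_mat n2 n2" and C1: "C1 \<in> carrier_mat q n1" and
    PQ: "P * Q = 1\<^sub>m n" and
    QAP: "Q * A * P = four_block_mat A11 (0\<^sub>m n1 n2) A21 A22" and
    CP: "C * P = four_block_mat C1 (0\<^sub>m q n2) (0\<^sub>m 0 n1) (0\<^sub>m 0 n2)"
    by blast
  \<comment> \<open>As \<open>n1\<close> comes from a truncated subtraction,
    \<open>n = n1 + n2\<close> is not automatic; the row count of the block form supplies
    it.\<close>
  have "dim_row (Q * A * P) = n1 + n2" unfolding QAP using A11 A22 by simp
  then have n: "n = n1 + n2" using Q by simp
  define E where "E = first_coords n1 n2"
  define G where "G = last_embed n1 n2"
  have E: "E \<in> carrier_mat n1 n" and G: "G \<in> carrier_mat n n2"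
    by (auto simp: E_def G_def n)
  note intertwine = lower_block_intertwine[OF A11 A21 A22 C1, folded QAP CP E_def G_def]
  have CP1: "C * P = C1 * E" unfolding E_def mult_first_coords[OF C1] by (rule CP)
  define R where "R = E * Q"
  define S where "S = P * G"
  show thesis
  proof (rule that)
    show "n1 = n - kernel_dim (obs_mat A C)" by (simp add: n1_def n2_def)
    show "R \<in> carrier_mat n1 n" "S \<in> carrier_mat n n2" using E Q P G by (auto simp: R_def S_def)
    \<comment> \<open>Inserting \<open>P * Q\<close>, the identity, creates the factor
      \<open>Q * A * P\<close>, to which the intertwining identities apply.\<close>
    have "R * A = E * Q * A * (P * Q)" using E Q A PQ by (simp add: R_def)
    also have "\<dots> = E * (Q * A * P) * Q" using E Q A P
      by (simp add: assoc_mult_mat[of _ n1 n _ n _ n] assoc_mult_mat[of _ n n _ n _ n])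
    also have "\<dots> = A11 * R" unfolding intertwine R_def using A11 E Q by simp
    finally show "R * A = A11 * R" .
    have "C = C * (P * Q)" using C PQ by simp
    also have "\<dots> = C1 * E * Q" using C P Q CP1 by (simp flip: assoc_mult_mat)
    finally show "C = C1 * R" using C1 E Q by (simp add: R_def)
    have "A * S = (P * Q) * (A * (P * G))" using PQ A P G by (simp add: S_def)
    also have "\<dots> = P * (Q * A * P * G)" using P Q A G
      by (simp add: assoc_mult_mat[of _ n n _ n _ n] assoc_mult_mat[of _ n n _ n _ n2])
    also have "\<dots> = S * A22" unfolding intertwine S_def using P G A22 by simp
    finally show "A * S = S * A22" .
    show "C * S = 0\<^sub>m q n2" using intertwine(3) C P G by (simp add: S_def)
    fix v :: "real vec" assume v: "v \<in> carrier_vec n" and Rv: "R *\<^sub>v v = 0\<^sub>v n1"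
    \<comment> \<open>In the new coordinates, \<open>R *\<^sub>v v = 0\<^sub>v n1\<close> says that
      the first \<open>n1\<close> entries of \<open>Q *\<^sub>v v\<close> vanish, so its remaining
      entries determine \<open>v\<close>.\<close>
    define z where "z = vec n2 (\<lambda>i. (Q *\<^sub>v v) $ (n1 + i))"
    have z: "z \<in> carrier_vec n2" by (simp add: z_def)
    have Qv: "Q *\<^sub>v v = G *\<^sub>v z"
    proof (rule eq_vecI)
      fix i assume "i < dim_vec (G *\<^sub>v z)"
      then have i: "i < n" using G by simp
      show "(Q *\<^sub>v v) $ i = (G *\<^sub>v z) $ i"
      proof (cases "i < n1")
        case True
        have "(Q *\<^sub>v v) $ i = (E *\<^sub>v (Q *\<^sub>v v)) $ i"
          using True n Q by (simp add: E_def first_coords_def scalar_prod_def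
            if_distrib[of "\<lambda>x. x * _"] cong: if_cong)
        also have "\<dots> = 0" using Rv True E Q v by (simp add: R_def)
        finally show ?thesis using True i n
          by (simp add: G_def last_embed_def scalar_prod_def z_def)
      next
        case False
        then obtain k where "i = n1 + k" "k < n2"
          using i n by (metis add_less_cancel_left le_Suc_ex not_less)
        then show ?thesis
          by (simp add: G_def last_embed_def scalar_prod_def z_def n
            if_distrib[of "\<lambda>x. x * _"] cong: if_cong)
      qed
    qed (use G Q in simp)
    have "v = (P * Q) *\<^sub>v v" using PQ v by simp
    also have "\<dots> = S *\<^sub>v z" using P Q v G z by (simp add: Qv S_def)
    finally show "\<exists>z\<in>carrier_vec n2. v = S *\<^sub>v z" using z by blast
  qed (use A11 A22 C1 in auto)
qed

section \<open>Matrices of full column rank\<close>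

text \<open>A nonzero \<open>v\<close> would be a linear dependence among the columns. Independence
  is a property of the set of columns, so repeated columns have to be excluded first: a maximal
  independent subset already has \<open>n\<close> elements, which leaves no room for
  repetitions.\<close>

lemma full_column_rank_mult_eq_0:
  fixes M :: "real mat"
  assumes M: "M \<in> carrier_mat m n" and rank: "mat_rank M = n"
    and v: "v \<in> carrier_vec n" and Mv: "M *\<^sub>v v = 0\<^sub>v m"
  shows "v = 0\<^sub>v n"
proof -
  interpret vec_space "TYPE(real)" m .
  have rank: "rank M = n" using rank M by simp
  obtain S where S: "maximal S (\<lambda>T. T \<subseteq> set (cols M) \<and> lin_indpt T)"
    using maximal_exists[of "(\<lambda>T. T \<subseteq> set (cols M) \<and> lin_indpt T)" "card (set (cols M))" "{}"]
    by (meson List.finite_set card_mono empty_iff empty_subsetI finite_lin_indpt2 rev_finite_subset)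
  then have "card S \<le> card (set (cols M))" by (simp add: card_mono maximal_def)
  moreover have "card S = n" using rank_card_indpt[OF M S] rank by simp
  ultimately have "distinct (cols M)"
    using M card_length[of "cols M"] by (intro card_distinct) auto
  with full_rank_lin_indpt[OF M rank] lin_depI[OF M v _ Mv] show ?thesis by auto
qed

lemma vstack_mult_vec_eq_0:
  assumes Ms: "\<And>N. N \<in> set Ms \<Longrightarrow> dim_col N = nc \<and> N *\<^sub>v v = 0\<^sub>v (dim_row N)"
  shows "vstack nc Ms *\<^sub>v v = 0\<^sub>v (dim_row (vstack nc Ms))"
proof (rule eq_vecI)
  fix i assume "i < dim_vec (0\<^sub>v (dim_row (vstack nc Ms)) :: real vec)"
  then have i: "i < length (concat (map rows Ms))" by (simp add: vstack_def)
  then have "concat (map rows Ms) ! i \<in> set (concat (map rows Ms))" by (rule nth_mem)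
  then obtain N k where N: "N \<in> set Ms" "k < dim_row N" "concat (map rows Ms) ! i = row N k"
    by (auto simp: rows_def)
  have "row (vstack nc Ms) i = row N k"
    unfolding vstack_def using i N Ms[OF N(1)]
    by (metis mat_of_rows_row row_carrier)
  moreover have "row N k \<bullet> v = (N *\<^sub>v v) $ k" using N by simp
  ultimately show "(vstack nc Ms *\<^sub>v v) $ i = 0\<^sub>v (dim_row (vstack nc Ms)) $ i"
    using i N Ms[OF N(1)] by (simp add: vstack_def)
qed simp

text \<open>The form in which the rank condition on the samples is used: one block per sampling
  time, each annihilating \<open>v\<close>.\<close>

lemma full_rank_vstack_mult_eq_0:
  assumes "mat_rank (vstack n Ms) = n" "v \<in> carrier_vec n"
    and "\<And>N. N \<in> set Ms \<Longrightarrow> dim_col N = n \<and> N *\<^sub>v v = 0\<^sub>v (dim_row N)"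
  shows "v = 0\<^sub>v n"
  by (rule full_column_rank_mult_eq_0[OF _ assms(1,2) vstack_mult_vec_eq_0[OF assms(3)]])
    (auto simp: vstack_def)

section \<open>The matrix exponential\<close>

lemma pow_smult_mat:
  fixes M :: "'a::comm_semiring_1 mat"
  assumes M: "M \<in> carrier_mat n n"
  shows "(t \<cdot>\<^sub>m M) ^\<^sub>m k = t ^ k \<cdot>\<^sub>m (M ^\<^sub>m k)"
proof (induction k)
  case 0
  then show ?case using M by (auto intro!: eq_matI)
next
  case (Suc k)
  have "M ^\<^sub>m k \<in> carrier_mat n n" using M by simp
  then show ?case using M Suc
    by (auto intro!: eq_matI simp: ac_simps)
qed

lemma pow_mat_Suc_left:
  fixes M :: "'a::semiring_1 mat"
  assumes M: "M \<in> carrier_mat n n"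
  shows "M ^\<^sub>m Suc k = M * M ^\<^sub>m k"
proof (induction k)
  case (Suc k)
  then show ?case using M by (simp add: assoc_mult_mat[of M n n _ n M n])
qed (use M in simp)

text \<open>A crude substitute for an operator norm: it dominates every absolute row sum, so one
  constant bounds all coordinates of a product.\<close>

abbreviation entry_sum :: "real mat \<Rightarrow> real" where
  "entry_sum M \<equiv> \<Sum>i<dim_row M. \<Sum>j<dim_col M. \<bar>M $$ (i, j)\<bar>"

lemma abs_mult_mat_vec_le:
  assumes M: "M \<in> carrier_mat m n" and i: "i < m" and v: "v \<in> carrier_vec n"
    and b: "\<And>j. j < n \<Longrightarrow> \<bar>v $ j\<bar> \<le> b" and "0 \<le> b"
  shows "\<bar>(M *\<^sub>v v) $ i\<bar> \<le> entry_sum M * b"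
proof -
  have "\<bar>(M *\<^sub>v v) $ i\<bar> = \<bar>\<Sum>j<n. M $$ (i, j) * v $ j\<bar>"
    using M i v by (simp add: scalar_prod_def atLeast0LessThan)
  also have "\<dots> \<le> (\<Sum>j<n. \<bar>M $$ (i, j)\<bar> * b)"
    by (rule order_trans[OF sum_abs]) (auto intro!: sum_mono mult_left_mono b simp: abs_mult)
  also have "\<dots> = (\<Sum>j<n. \<bar>M $$ (i, j)\<bar>) * b" by (simp add: sum_distrib_right)
  also have "(\<Sum>j<n. \<bar>M $$ (i, j)\<bar>) \<le> entry_sum M"
    using M i member_le_sum[of i "{..<m}" "\<lambda>i. \<Sum>j<n. \<bar>M $$ (i, j)\<bar>"] by (simp add: sum_nonneg)
  finally show ?thesis using \<open>0 \<le> b\<close> by (simp add: mult_right_mono)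
qed

lemma abs_pow_mat_le:
  assumes M: "M \<in> carrier_mat n n" and "i < n" and j: "j < n"
  shows "\<bar>(M ^\<^sub>m k) $$ (i, j)\<bar> \<le> entry_sum M ^ k"
  using \<open>i < n\<close>
\<comment> \<open>Row \<open>i\<close> of the next power involves all entries of column
  \<open>j\<close> of the previous one, so the row must be general.\<close>
proof (induction k arbitrary: i)
  case (Suc k)
  have "(M ^\<^sub>m Suc k) $$ (i, j) = (M *\<^sub>v col (M ^\<^sub>m k) j) $ i"
    unfolding pow_mat_Suc_left[OF M] using M Suc.prems j by simp
  also have "\<bar>\<dots>\<bar> \<le> entry_sum M * entry_sum M ^ k"
    using M Suc j by (intro abs_mult_mat_vec_le[OF M]) (auto simp: sum_nonneg carrier_vecI)
  finally show ?case by simp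
qed (use M j in simp)

lemma mat_exp_carrier [simp]: "M \<in> carrier_mat n n \<Longrightarrow> mat_exp M \<in> carrier_mat n n"
  by (auto simp: mat_exp_def)

text \<open>Taking the scalar out of the powers exhibits each entry as a power series in
  \<open>t\<close>, ready for termwise differentiation.\<close>

lemma mat_exp_smult_index:
  assumes M: "M \<in> carrier_mat n n" and "i < n" "j < n"
  shows "mat_exp (t \<cdot>\<^sub>m M) $$ (i, j) = (\<Sum>k. (M ^\<^sub>m k) $$ (i, j) / fact k * t ^ k)"
  using assms by (auto simp: mat_exp_def pow_smult_mat[OF M] mult.commute)

lemma mat_exp_0:
  assumes M: "M \<in> carrier_mat n n"
  shows "mat_exp (0 \<cdot>\<^sub>m M) = 1\<^sub>m n"
proof (rule eq_matI)
  fix i j assume "i < dim_row (1\<^sub>m n :: real mat)" "j < dim_col (1\<^sub>m n :: real mat)"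
  then have ij: "i < n" "j < n" by simp_all
  show "mat_exp (0 \<cdot>\<^sub>m M) $$ (i, j) = 1\<^sub>m n $$ (i, j)"
    unfolding mat_exp_smult_index[OF M ij] powser_zero using M by simp
qed (use M in \<open>auto simp: mat_exp_def\<close>)

text \<open>Dominated by the scalar exponential series at
  \<open>entry_sum M * \<bar>t\<bar>\<close>.\<close>

lemma summable_mat_exp:
  fixes M :: "real mat"
  assumes M: "M \<in> carrier_mat n n" and "i < n" "j < n"
  shows "summable (\<lambda>k. (M ^\<^sub>m k) $$ (i, j) / fact k * t ^ k)"
proof (rule summable_comparison_test')
  show "summable (\<lambda>k. inverse (fact k) * (entry_sum M * \<bar>t\<bar>) ^ k)" by (rule summable_exp)
  show "norm ((M ^\<^sub>m k) $$ (i, j) / fact k * t ^ k) \<le> inverse (fact k) * (entry_sum M * \<bar>t\<bar>) ^ k"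
    if "k \<ge> 0" for k
    using mult_right_mono[OF abs_pow_mat_le[OF assms, of k], of "\<bar>t\<bar> ^ k / fact k"]
    by (simp add: abs_mult power_abs power_mult_distrib field_simps)
qed

text \<open>Termwise differentiation turns the coefficient \<open>M ^\<^sub>m k / k!\<close> into
  \<open>M ^\<^sub>m Suc k / k!\<close>. Splitting off one factor \<open>M\<close> on the left gives
  a finite sum over \<open>l\<close>, which may be exchanged with the series.\<close>

lemma mat_exp_has_derivative:
  assumes M: "M \<in> carrier_mat n n" and i: "i < n" and j: "j < n"
  shows "((\<lambda>t. mat_exp (t \<cdot>\<^sub>m M) $$ (i, j)) has_real_derivative
    (M * mat_exp (t \<cdot>\<^sub>m M)) $$ (i, j)) (at t)"
proof -
  have E: "mat_exp (t \<cdot>\<^sub>m M) \<in> carrier_mat n n" using M by simp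
  let ?c = "\<lambda>i k. (M ^\<^sub>m k) $$ (i, j) / fact k"
  have "((\<lambda>t. \<Sum>k. ?c i k * t ^ k) has_real_derivative (\<Sum>k. diffs (?c i) k * t ^ k)) (at t)"
    by (rule termdiffs_strong_converges_everywhere) (rule summable_mat_exp[OF M i j])
  also have "(\<lambda>t. \<Sum>k. ?c i k * t ^ k) = (\<lambda>t. mat_exp (t \<cdot>\<^sub>m M) $$ (i, j))"
    using mat_exp_smult_index[OF M i j] by simp
  also have "(\<Sum>k. diffs (?c i) k * t ^ k) = (\<Sum>k. \<Sum>l<n. M $$ (i, l) * (?c l k * t ^ k))"
  proof (rule suminf_cong)
    fix k
    have "diffs (?c i) k = (M ^\<^sub>m Suc k) $$ (i, j) / fact k"
      unfolding diffs_def fact_Suc of_nat_mult by (simp del: of_nat_Suc pow_mat.simps)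
    also have "(M ^\<^sub>m Suc k) $$ (i, j) = (\<Sum>l<n. M $$ (i, l) * (M ^\<^sub>m k) $$ (l, j))"
      unfolding pow_mat_Suc_left[OF M] using M i j
      by (simp add: scalar_prod_def atLeast0LessThan)
    finally show "diffs (?c i) k * t ^ k = (\<Sum>l<n. M $$ (i, l) * (?c l k * t ^ k))"
      by (simp add: sum_divide_distrib sum_distrib_right mult.assoc)
  qed
  also have "\<dots> = (\<Sum>l<n. \<Sum>k. M $$ (i, l) * (?c l k * t ^ k))"
    by (intro suminf_sum summable_mult summable_mat_exp[OF M _ j]) simp
  also have "\<dots> = (\<Sum>l<n. M $$ (i, l) * mat_exp (t \<cdot>\<^sub>m M) $$ (l, j))"
    by (intro sum.cong refl) (simp only: suminf_mult[OF summable_mat_exp[OF M _ j]]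
      mat_exp_smult_index[OF M _ j] lessThan_iff)
  also have "\<dots> = (M * mat_exp (t \<cdot>\<^sub>m M)) $$ (i, j)"
    using M i j carrier_matD[OF E] by (simp add: scalar_prod_def atLeast0LessThan)
  finally show ?thesis .
qed

section \<open>Linear integral equations\<close>

lemma mult_mat_vec_has_integral:
  fixes M :: "real mat"
  assumes M: "M \<in> carrier_mat m n" and i: "i < m"
    and f: "\<And>s. s \<in> I \<Longrightarrow> f s \<in> carrier_vec n" and g: "g \<in> carrier_vec n"
    and int: "\<And>j. j < n \<Longrightarrow> ((\<lambda>s. f s $ j) has_integral g $ j) I"
  shows "((\<lambda>s. (M *\<^sub>v f s) $ i) has_integral (M *\<^sub>v g) $ i) I"
proof -
  have "((\<lambda>s. \<Sum>j<n. M $$ (i, j) * f s $ j) has_integral (\<Sum>j<n. M $$ (i, j) * g $ j)) I"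
    by (intro has_integral_sum has_integral_mult_right int) auto
  also have "(\<Sum>j<n. M $$ (i, j) * g $ j) = (M *\<^sub>v g) $ i"
    using M i g by (simp add: scalar_prod_def atLeast0LessThan)
  finally show ?thesis
    by (rule has_integral_eq[rotated])
      (use M i f in \<open>auto simp: scalar_prod_def atLeast0LessThan dest: f\<close>)
qed

text \<open>The fundamental theorem of calculus brings the exponential flow into the integrated form
  that \<open>ct_trajectory\<close> demands.\<close>

lemma mat_exp_mult_vec_has_integral:
  assumes M: "M \<in> carrier_mat n n" and z: "z \<in> carrier_vec n" and i: "i < n" and "0 \<le> t"
  shows "((\<lambda>s. (M *\<^sub>v (mat_exp (s \<cdot>\<^sub>m M) *\<^sub>v z)) $ i) has_integral
    (mat_exp (t \<cdot>\<^sub>m M) *\<^sub>v z) $ i - z $ i) {0..t}"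
proof -
  have E: "mat_exp (s \<cdot>\<^sub>m M) \<in> carrier_mat n n" for s using M by simp
  have eq: "(mat_exp (s \<cdot>\<^sub>m M) *\<^sub>v z) $ i = (\<Sum>j<n. mat_exp (s \<cdot>\<^sub>m M) $$ (i, j) * z $ j)" for s
    using E[of s] i z by (simp add: scalar_prod_def atLeast0LessThan)
  have eq': "(M *\<^sub>v (mat_exp (s \<cdot>\<^sub>m M) *\<^sub>v z)) $ i =
      (\<Sum>j<n. (M * mat_exp (s \<cdot>\<^sub>m M)) $$ (i, j) * z $ j)" for s
    unfolding assoc_mult_mat_vec[OF M E z, symmetric]
    using carrier_matD[OF E[of s]] M i z
    by (simp add: scalar_prod_def[of _ z] atLeast0LessThan del: index_mult_mat(1))
  have "((\<lambda>s. (mat_exp (s \<cdot>\<^sub>m M) *\<^sub>v z) $ i) has_real_derivative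
      (M *\<^sub>v (mat_exp (s \<cdot>\<^sub>m M) *\<^sub>v z)) $ i) (at s)" for s
    unfolding eq eq' by (intro DERIV_sum DERIV_cmult_right mat_exp_has_derivative[OF M i]) simp
  then have "((\<lambda>s. (M *\<^sub>v (mat_exp (s \<cdot>\<^sub>m M) *\<^sub>v z)) $ i) has_integral
      (mat_exp (t \<cdot>\<^sub>m M) *\<^sub>v z) $ i - (mat_exp (0 \<cdot>\<^sub>m M) *\<^sub>v z) $ i) {0..t}"
    by (intro fundamental_theorem_of_calculus \<open>0 \<le> t\<close>)
      (auto simp: has_real_derivative_iff_has_vector_derivative intro: has_vector_derivative_at_within)
  then show ?thesis using M z by (simp add: mat_exp_0)
qed

text \<open>Iterating the integral inequality improves the bound \<open>K\<close> to \<open>K (L t)\<^sup>k / k!\<close>.\<close>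

lemma linear_integral_equation_zero:
  fixes M :: "real mat" and d :: "real \<Rightarrow> real vec"
  assumes M: "M \<in> carrier_mat n n"
    and d: "\<And>t. t \<in> {0..T} \<Longrightarrow> d t \<in> carrier_vec n"
    and int: "\<And>i t. i < n \<Longrightarrow> t \<in> {0..T} \<Longrightarrow>
      ((\<lambda>s. (M *\<^sub>v d s) $ i) has_integral d t $ i) {0..t}"
    and t: "t \<in> {0..T}"
  shows "d t = 0\<^sub>v n"
proof -
  \<comment> \<open>The equation itself provides regularity: each coordinate of \<open>d\<close> is
    an indefinite integral, hence continuous, hence bounded on the compact interval.\<close>
  have "\<exists>K. \<forall>t\<in>{0..T}. \<bar>d t $ i\<bar> \<le> K" if i: "i < n" for i
  proof -
    have "continuous_on {0..T} (\<lambda>t. integral {0..t} (\<lambda>s. (M *\<^sub>v d s) $ i))"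
      using int[OF i, of T] t by (intro indefinite_integral_continuous_1) (auto simp: integrable_on_def)
    then have "continuous_on {0..T} (\<lambda>t. d t $ i)"
      by (rule continuous_on_eq) (use int[OF i] in \<open>auto intro: integral_unique\<close>)
    then have "bounded ((\<lambda>t. d t $ i) ` {0..T})"
      by (intro compact_imp_bounded compact_continuous_image) auto
    then show ?thesis by (auto simp: bounded_iff)
  qed
  then obtain K' where K': "\<And>i t. i < n \<Longrightarrow> t \<in> {0..T} \<Longrightarrow> \<bar>d t $ i\<bar> \<le> K' i" by metis
  define K where "K = (\<Sum>i<n. \<bar>K' i\<bar>)"
  define L where "L = entry_sum M"
  have "0 \<le> K" "0 \<le> L" by (auto simp: K_def L_def sum_nonneg)
  have K: "\<bar>d t $ i\<bar> \<le> K" if "i < n" "t \<in> {0..T}" for i t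
  proof -
    have "\<bar>K' i\<bar> \<le> K" unfolding K_def using that by (intro member_le_sum) auto
    then show ?thesis using K'[OF that] by linarith
  qed
  have bound: "\<bar>d t $ i\<bar> \<le> K * ((L * t) ^ k / fact k)" if "i < n" "t \<in> {0..T}" for i t k
    using that
  proof (induction k arbitrary: i t)
    case 0
    then show ?case using K by simp
  next
    case (Suc k)
    \<comment> \<open>\<open>?b\<close> is the old bound multiplied by \<open>L\<close>, so it
      bounds the integrand; \<open>?B\<close>, the new bound, is its antiderivative and vanishes at
      0 because of the exponent \<open>Suc k\<close>.\<close>
    let ?b = "\<lambda>s. L * (K * ((L * s) ^ k / fact k))"
    let ?B = "\<lambda>s. K * ((L * s) ^ Suc k / fact (Suc k))"
    have deriv: "(?B has_real_derivative ?b s) (at s)" for s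
    proof -
      have "(?B has_real_derivative K * (real (Suc k) * (L * s) ^ k * L / fact (Suc k))) (at s)"
        by (rule derivative_eq_intros refl | simp)+
      then show ?thesis by (simp add: field_simps del: of_nat_Suc)
    qed
    have "(?b has_integral ?B t - ?B 0) {0..t}"
      using deriv Suc.prems by (intro fundamental_theorem_of_calculus)
        (auto simp: has_real_derivative_iff_has_vector_derivative intro: has_vector_derivative_at_within)
    moreover have "?B 0 = 0" by simp
    ultimately have "(?b has_integral ?B t) {0..t}" by (simp only: diff_0_right)
    note b = has_integral_integrable[OF this] integral_unique[OF this]
    have "\<bar>(M *\<^sub>v d s) $ i\<bar> \<le> ?b s" if "s \<in> {0..t}" for s
      unfolding L_def
      by (rule abs_mult_mat_vec_le[OF M]) 
        (use that Suc d \<open>0 \<le> K\<close> \<open>0 \<le> L\<close> in \<open>auto simp: L_def[symmetric]\<close>)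
    then have "norm (integral {0..t} (\<lambda>s. (M *\<^sub>v d s) $ i)) \<le> integral {0..t} ?b"
      using b int[OF Suc.prems] by (intro integral_norm_bound_integral) (auto simp: integrable_on_def)
    then show ?case unfolding b(2) integral_unique[OF int[OF Suc.prems]] real_norm_def .
  qed
  show ?thesis
  proof (rule eq_vecI)
    fix i assume "i < dim_vec (0\<^sub>v n :: real vec)"
    then have i: "i < n" by simp
    \<comment> \<open>These are the terms of the convergent exponential series, so the bounds on
      \<open>d t\<close> shrink to 0.\<close>
    have "(\<lambda>k. (L * t) ^ k / fact k) \<longlonglongrightarrow> 0"
      using summable_LIMSEQ_zero[OF summable_exp[of "L * t"]] by (simp add: field_simps)
    from tendsto_mult_right_zero[OF this] have "(\<lambda>k. K * ((L * t) ^ k / fact k)) \<longlonglongrightarrow> 0" .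
    from LIMSEQ_le_const[OF this] bound[OF i t] have "\<bar>d t $ i\<bar> \<le> 0" by blast
    then show "d t $ i = 0\<^sub>v n $ i" using i by simp
  qed (use d[OF t] in auto)
qed

text \<open>Subtracting the exponential flow with the same initial value leaves a solution of the
  homogeneous equation starting at zero, which must vanish.\<close>

lemma linear_integral_equation_solution:
  fixes M :: "real mat" and w :: "real \<Rightarrow> real vec"
  assumes M: "M \<in> carrier_mat n n"
    and w: "\<And>t. t \<in> {0..T} \<Longrightarrow> w t \<in> carrier_vec n"
    and int: "\<And>i t. i < n \<Longrightarrow> t \<in> {0..T} \<Longrightarrow>
      ((\<lambda>s. (M *\<^sub>v w s) $ i) has_integral w t $ i - w 0 $ i) {0..t}"
    and t: "t \<in> {0..T}"
  shows "w t = mat_exp (t \<cdot>\<^sub>m M) *\<^sub>v w 0"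
proof -
  have w0: "w 0 \<in> carrier_vec n" using w t by simp
  have E: "mat_exp (s \<cdot>\<^sub>m M) \<in> carrier_mat n n" for s using M by simp
  define d where "d s = w s - mat_exp (s \<cdot>\<^sub>m M) *\<^sub>v w 0" for s
  have Ew: "mat_exp (s \<cdot>\<^sub>m M) *\<^sub>v w 0 \<in> carrier_vec n" for s using E[of s] w0 by simp
  have "d t = 0\<^sub>v n"
  proof (rule linear_integral_equation_zero[OF M _ _ t])
    show "d s \<in> carrier_vec n" if "s \<in> {0..T}" for s using w[OF that] Ew[of s] by (simp add: d_def)
    fix i s assume i: "i < n" and s: "s \<in> {0..T}"
    have "((\<lambda>s. (M *\<^sub>v w s) $ i - (M *\<^sub>v (mat_exp (s \<cdot>\<^sub>m M) *\<^sub>v w 0)) $ i) has_integral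
        (w s $ i - w 0 $ i) - ((mat_exp (s \<cdot>\<^sub>m M) *\<^sub>v w 0) $ i - w 0 $ i)) {0..s}"
      using s by (intro has_integral_diff int[OF i s] mat_exp_mult_vec_has_integral[OF M w0 i]) auto
    also have "(w s $ i - w 0 $ i) - ((mat_exp (s \<cdot>\<^sub>m M) *\<^sub>v w 0) $ i - w 0 $ i) = d s $ i"
      using carrier_matD[OF E[of s]] i by (simp add: d_def)
    finally show "((\<lambda>s. (M *\<^sub>v d s) $ i) has_integral d s $ i) {0..s}"
    proof (rule has_integral_eq[rotated])
      fix x assume "x \<in> {0..s}"
      then have "w x \<in> carrier_vec n" using s w by auto
      then show "(M *\<^sub>v w x) $ i - (M *\<^sub>v (mat_exp (x \<cdot>\<^sub>m M) *\<^sub>v w 0)) $ i = (M *\<^sub>v d x) $ i"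
        unfolding d_def mult_minus_distrib_mat_vec[OF M \<open>w x \<in> _\<close> Ew] using M i E[of x] by simp
    qed
  qed
  then have "(w t - mat_exp (t \<cdot>\<^sub>m M) *\<^sub>v w 0) $ i = 0" if "i < n" for i
    using that by (simp add: d_def)
  then show ?thesis using w[OF t] carrier_matD[OF E[of t]] by (intro eq_vecI) auto
qed

section \<open>Trajectories\<close>

lemma mult_mat_vec_zero:
  fixes M :: "real mat"
  shows "M \<in> carrier_mat m n \<Longrightarrow> M *\<^sub>v 0\<^sub>v n = 0\<^sub>v m"
  by (auto intro!: eq_vecI)

text \<open>By \<open>A * S = S * N\<close> the range of \<open>S\<close> is invariant under
  \<open>A\<close>, so the flow of \<open>N\<close> lifts to a zero-input trajectory. It will serve
  to follow an unobservable initial state inside the unobservable subspace.\<close>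

lemma ct_trajectory_embed:
  assumes A: "A \<in> carrier_mat n n" and B: "B \<in> carrier_mat n m"
    and S: "S \<in> carrier_mat n k" and N: "N \<in> carrier_mat k k" and AS: "A * S = S * N"
    and z: "z \<in> carrier_vec k"
  shows "ct_trajectory A B (\<lambda>_. 0\<^sub>v m) (\<lambda>t. S *\<^sub>v (mat_exp (t \<cdot>\<^sub>m N) *\<^sub>v z))"
proof -
  let ?y = "\<lambda>t. mat_exp (t \<cdot>\<^sub>m N) *\<^sub>v z"
  have E: "mat_exp (t \<cdot>\<^sub>m N) \<in> carrier_mat k k" for t using N by simp
  have y: "?y t \<in> carrier_vec k" for t using mult_mat_vec_carrier[OF E z] .
  have "((\<lambda>s. (A *\<^sub>v (S *\<^sub>v ?y s) + B *\<^sub>v 0\<^sub>v m) $ i) has_integral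
      (S *\<^sub>v ?y t) $ i - (S *\<^sub>v ?y 0) $ i) {0..t}" if i: "i < n" and t: "0 \<le> t" for i t
  proof -
    have "A *\<^sub>v (S *\<^sub>v ?y s) = S *\<^sub>v (N *\<^sub>v ?y s)" for s
      unfolding assoc_mult_mat_vec[OF A S y, symmetric] AS assoc_mult_mat_vec[OF S N y] ..
    moreover have "S *\<^sub>v (?y t - z) = S *\<^sub>v ?y t - S *\<^sub>v z"
      by (rule mult_minus_distrib_mat_vec[OF S y z])
    moreover have "?y 0 = z" using N z by (simp add: mat_exp_0)
    moreover have "((\<lambda>s. (S *\<^sub>v (N *\<^sub>v ?y s)) $ i) has_integral (S *\<^sub>v (?y t - z)) $ i) {0..t}"
    proof (rule mult_mat_vec_has_integral[OF S i])
      fix j assume j: "j < k"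
      show "((\<lambda>s. (N *\<^sub>v ?y s) $ j) has_integral (?y t - z) $ j) {0..t}"
        using mat_exp_mult_vec_has_integral[OF N z j t] j z by simp
    qed (use mult_mat_vec_carrier[OF N y] y z in auto)
    ultimately show ?thesis using S B i by simp
  qed
  moreover have "S *\<^sub>v ?y t \<in> carrier_vec n" for t using mult_mat_vec_carrier[OF S y] .
  ultimately show ?thesis using A B by (auto simp: ct_trajectory_def)
qed

lemma ct_trajectory_diff_has_integral:
  assumes A: "A \<in> carrier_mat n n" and B: "B \<in> carrier_mat n m"
    and x: "ct_trajectory A B u x" and x': "ct_trajectory A B u' x'"
    and u: "\<forall>s\<in>{0..t}. u' s = u s" and t: "0 \<le> t" and i: "i < n"
  shows "((\<lambda>s. (A *\<^sub>v (x' s - x s)) $ i) has_integral (x' t - x t) $ i - (x' 0 - x 0) $ i) {0..t}"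
proof -
  have c: "x s \<in> carrier_vec n" "x' s \<in> carrier_vec n" if "0 \<le> s" for s
    using x x' A that by (auto simp: ct_trajectory_def)
  have "((\<lambda>s. (A *\<^sub>v x' s + B *\<^sub>v u' s) $ i - (A *\<^sub>v x s + B *\<^sub>v u s) $ i) has_integral
      (x' t $ i - x' 0 $ i) - (x t $ i - x 0 $ i)) {0..t}"
    using x x' A i t by (intro has_integral_diff) (auto simp: ct_trajectory_def)
  also have "(x' t $ i - x' 0 $ i) - (x t $ i - x 0 $ i) = (x' t - x t) $ i - (x' 0 - x 0) $ i"
    using c[of t] c[of 0] t i by simp
  finally show ?thesis
  proof (rule has_integral_eq[rotated])
    fix s assume s: "s \<in> {0..t}"
    then have cs: "x s \<in> carrier_vec n" "x' s \<in> carrier_vec n" using c by auto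
    show "(A *\<^sub>v x' s + B *\<^sub>v u' s) $ i - (A *\<^sub>v x s + B *\<^sub>v u s) $ i = (A *\<^sub>v (x' s - x s)) $ i"
      unfolding mult_minus_distrib_mat_vec[OF A cs(2,1)] using A B i s u by simp
  qed
qed

text \<open>The inputs cancel in the difference, and \<open>R * A = N * R\<close> closes the
  integral equation for its image under \<open>R\<close>; uniqueness of solutions then identifies
  that image with the flow of \<open>N\<close>.\<close>

lemma ct_trajectory_diff_eq:
  assumes A: "A \<in> carrier_mat n n" and B: "B \<in> carrier_mat n m"
    and R: "R \<in> carrier_mat k n" and N: "N \<in> carrier_mat k k" and RA: "R * A = N * R"
    and x: "ct_trajectory A B u x" and x': "ct_trajectory A B u' x'"
    and u: "\<forall>s\<in>{0..T}. u' s = u s" and t: "t \<in> {0..T}"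
  shows "R *\<^sub>v (x' t - x t) = mat_exp (t \<cdot>\<^sub>m N) *\<^sub>v (R *\<^sub>v (x' 0 - x 0))"
proof (rule linear_integral_equation_solution[OF N _ _ t])
  have e: "x' s - x s \<in> carrier_vec n" if "0 \<le> s" for s
    using x x' A that by (auto simp: ct_trajectory_def)
  show "R *\<^sub>v (x' s - x s) \<in> carrier_vec k" if "s \<in> {0..T}" for s
    using e[of s] R that by auto
  fix i s assume i: "i < k" and s: "s \<in> {0..T}"
  have e0: "x' 0 - x 0 \<in> carrier_vec n" and es: "x' s - x s \<in> carrier_vec n"
    using e s by auto
  \<comment> \<open>The equation for the full difference is integrated first and \<open>R\<close>
    applied afterwards; only then is \<open>R * A\<close> exchanged for
    \<open>N * R\<close>.\<close>
  have "((\<lambda>v. (R *\<^sub>v (A *\<^sub>v (x' v - x v))) $ i) has_integral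
      (R *\<^sub>v ((x' s - x s) - (x' 0 - x 0))) $ i) {0..s}"
  proof (rule mult_mat_vec_has_integral[OF R i])
    fix j assume j: "j < n"
    then show "((\<lambda>v. (A *\<^sub>v (x' v - x v)) $ j) has_integral ((x' s - x s) - (x' 0 - x 0)) $ j) {0..s}"
      using ct_trajectory_diff_has_integral[OF A B x x' _ _ j, of s] u s carrier_vecD[OF e0] by auto
  qed (use A e e0 es s in auto)
  also have "(R *\<^sub>v ((x' s - x s) - (x' 0 - x 0))) $ i
      = (R *\<^sub>v (x' s - x s)) $ i - (R *\<^sub>v (x' 0 - x 0)) $ i"
    unfolding mult_minus_distrib_mat_vec[OF R es e0] using R i by simp
  finally show "((\<lambda>v. (N *\<^sub>v (R *\<^sub>v (x' v - x v))) $ i) has_integral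
      (R *\<^sub>v (x' s - x s)) $ i - (R *\<^sub>v (x' 0 - x 0)) $ i) {0..s}"
  proof (rule has_integral_eq[rotated])
    fix v assume "v \<in> {0..s}"
    then have ev: "x' v - x v \<in> carrier_vec n" using e by simp
    show "(R *\<^sub>v (A *\<^sub>v (x' v - x v))) $ i = (N *\<^sub>v (R *\<^sub>v (x' v - x v))) $ i"
      unfolding assoc_mult_mat_vec[OF R A ev, symmetric] RA assoc_mult_mat_vec[OF N R ev] ..
  qed
qed

section \<open>Trajectories in discrete time\<close>

lemma dt_trajectory_embed:
  assumes A: "A \<in> carrier_mat n n" and B: "B \<in> carrier_mat n m"
    and S: "S \<in> carrier_mat n k" and N: "N \<in> carrier_mat k k" and AS: "A * S = S * N"
    and z: "z \<in> carrier_vec k"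
  shows "dt_trajectory A B (\<lambda>_. 0\<^sub>v m) (\<lambda>t. S *\<^sub>v (N ^\<^sub>m nat t *\<^sub>v z))"
proof -
  have y: "N ^\<^sub>m l *\<^sub>v z \<in> carrier_vec k" for l
    by (rule mult_mat_vec_carrier[OF pow_carrier_mat[OF N] z])
  have Sy: "S *\<^sub>v (N ^\<^sub>m l *\<^sub>v z) \<in> carrier_vec n" for l
    by (rule mult_mat_vec_carrier[OF S y])
  have "S *\<^sub>v (N ^\<^sub>m nat (t + 1) *\<^sub>v z) = A *\<^sub>v (S *\<^sub>v (N ^\<^sub>m nat t *\<^sub>v z)) + B *\<^sub>v 0\<^sub>v m"
    if "0 \<le> t" for t
  proof -
    have "N ^\<^sub>m nat (t + 1) *\<^sub>v z = N *\<^sub>v (N ^\<^sub>m nat t *\<^sub>v z)"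
      using that pow_mat_Suc_left[OF N, of "nat t"]
        assoc_mult_mat_vec[OF N pow_carrier_mat[OF N] z, of "nat t"]
      by (simp add: nat_add_distrib del: pow_mat.simps)
    moreover have "A *\<^sub>v (S *\<^sub>v (N ^\<^sub>m l *\<^sub>v z)) = S *\<^sub>v (N *\<^sub>v (N ^\<^sub>m l *\<^sub>v z))" for l
      unfolding assoc_mult_mat_vec[OF A S y, symmetric] AS assoc_mult_mat_vec[OF S N y] ..
    moreover have "B *\<^sub>v 0\<^sub>v m = 0\<^sub>v n" by (rule mult_mat_vec_zero[OF B])
    moreover have "A *\<^sub>v (S *\<^sub>v (N ^\<^sub>m l *\<^sub>v z)) \<in> carrier_vec n" for l
      by (rule mult_mat_vec_carrier[OF A Sy])
    ultimately show ?thesis by simp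
  qed
  then show ?thesis using A B Sy by (auto simp: dt_trajectory_def)
qed

lemma dt_trajectory_diff_eq:
  assumes A: "A \<in> carrier_mat n n" and B: "B \<in> carrier_mat n m"
    and R: "R \<in> carrier_mat k n" and N: "N \<in> carrier_mat k k" and RA: "R * A = N * R"
    and x: "dt_trajectory A B u x" and x': "dt_trajectory A B u' x'"
    and u: "\<forall>s\<in>{0..T}. u' s = u s" and t: "t \<in> {0..T}"
  shows "R *\<^sub>v (x' t - x t) = N ^\<^sub>m nat t *\<^sub>v (R *\<^sub>v (x' 0 - x 0))"
proof -
  have c: "x s \<in> carrier_vec n" "x' s \<in> carrier_vec n" if "0 \<le> s" for s
    using x x' A that by (auto simp: dt_trajectory_def)
  have e: "x' s - x s \<in> carrier_vec n" if "0 \<le> s" for s using c[OF that] by simp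
  have w: "R *\<^sub>v (x' s - x s) \<in> carrier_vec k" if "0 \<le> s" for s
    by (rule mult_mat_vec_carrier[OF R e[OF that]])
  \<comment> \<open>Times are integers, so the induction runs over naturals; the bound by
    \<open>T\<close> keeps every step within the range where the inputs agree.\<close>
  have "R *\<^sub>v (x' (int l) - x (int l)) = N ^\<^sub>m l *\<^sub>v (R *\<^sub>v (x' 0 - x 0))" if "int l \<le> T" for l
    using that
  proof (induction l)
    case 0
    then show ?case using w[of 0] N by simp
  next
    case (Suc l)
    have cs: "x (int l) \<in> carrier_vec n" "x' (int l) \<in> carrier_vec n" using c by auto
    have "x' (int l + 1) - x (int l + 1)
        = (A *\<^sub>v x' (int l) + B *\<^sub>v u (int l)) - (A *\<^sub>v x (int l) + B *\<^sub>v u (int l))"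
      using x x' u Suc.prems by (simp add: dt_trajectory_def)
    also have "\<dots> = A *\<^sub>v (x' (int l) - x (int l))"
      unfolding mult_minus_distrib_mat_vec[OF A cs(2,1)] using A B by (intro eq_vecI) auto
    finally have "R *\<^sub>v (x' (int (Suc l)) - x (int (Suc l))) = R *\<^sub>v (A *\<^sub>v (x' (int l) - x (int l)))"
      by (simp add: add.commute)
    also have "\<dots> = N *\<^sub>v (R *\<^sub>v (x' (int l) - x (int l)))"
      using assoc_mult_mat_vec[OF R A e[of "int l"]] assoc_mult_mat_vec[OF N R e[of "int l"]] RA
      by simp
    also have "\<dots> = N *\<^sub>v (N ^\<^sub>m l *\<^sub>v (R *\<^sub>v (x' 0 - x 0)))" using Suc by simp
    also have "\<dots> = N ^\<^sub>m Suc l *\<^sub>v (R *\<^sub>v (x' 0 - x 0))"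
      unfolding pow_mat_Suc_left[OF N]
      using assoc_mult_mat_vec[OF N pow_carrier_mat[OF N] w[of 0]] by simp
    finally show ?case .
  qed
  from this[of "nat t"] t show ?thesis by simp
qed

section \<open>Reconstruction from samples\<close>

text \<open>The trajectories from \<open>z\<close> and from \<open>0\<^sub>v k\<close> share the
  input, and \<open>C\<close> annihilates both, so their outputs agree on whatever horizon
  functional observability provides. Hence \<open>F\<close> takes the same value at both initial
  states, namely zero.\<close>

lemma functionally_observable_embed:
  assumes fo: "functionally_observable Traj C D F"
    and F: "F \<in> carrier_mat r n" and S: "S \<in> carrier_mat n k"
    and traj: "\<And>z. z \<in> carrier_vec k \<Longrightarrow> Traj u (X z)"
    and X0: "\<And>z. z \<in> carrier_vec k \<Longrightarrow> X z 0 = S *\<^sub>v z"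
    and CX: "\<And>z t. z \<in> carrier_vec k \<Longrightarrow> C *\<^sub>v X z t = 0\<^sub>v q"
    and z: "z \<in> carrier_vec k"
  shows "F *\<^sub>v (S *\<^sub>v z) = 0\<^sub>v r"
proof -
  have 0: "0\<^sub>v k \<in> carrier_vec k" by simp
  have "F *\<^sub>v X z 0 = F *\<^sub>v X (0\<^sub>v k) 0"
    using fo[unfolded functionally_observable_def, rule_format, OF traj[OF 0]] traj[OF z]
    by (auto simp: CX[OF z] CX[OF 0])
  also have "\<dots> = 0\<^sub>v r"
    unfolding X0[OF 0] mult_mat_vec_zero[OF S] by (rule mult_mat_vec_zero[OF F])
  finally show ?thesis by (simp add: X0[OF z])
qed

text \<open>The argument common to both time domains; \<open>\<Phi>\<close> stands for the flow of
  the observable subsystem, a matrix exponential or a matrix power.\<close>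

lemma sample_based_functionally_observableI:
  assumes C: "C = C1 * R" and C1: "C1 \<in> carrier_mat q k" and R: "R \<in> carrier_mat k n"
    and D: "D \<in> carrier_mat q m" and F: "F \<in> carrier_mat r n"
    and ts: "\<And>t. t \<in> set ts \<Longrightarrow> 0 \<le> t"
    and car: "\<And>u x t. Traj u x \<Longrightarrow> 0 \<le> t \<Longrightarrow> x t \<in> carrier_vec n"
    and flow: "\<And>t. \<Phi> t \<in> carrier_mat k k"
    and diff: "\<And>u x u' x' T t. Traj u x \<Longrightarrow> Traj u' x' \<Longrightarrow> \<forall>s\<in>{0..T}. u' s = u s \<Longrightarrow>
      t \<in> {0..T} \<Longrightarrow> R *\<^sub>v (x' t - x t) = \<Phi> t *\<^sub>v (R *\<^sub>v (x' 0 - x 0))"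
    and rank: "mat_rank (vstack k (map (\<lambda>t. C1 * \<Phi> t) ts)) = k"
    and ker: "\<And>v. v \<in> carrier_vec n \<Longrightarrow> R *\<^sub>v v = 0\<^sub>v k \<Longrightarrow> F *\<^sub>v v = 0\<^sub>v r"
  shows "sample_based_functionally_observable Traj C D F \<sigma> ts"
proof -
  \<comment> \<open>The horizon has to exceed \<open>\<sigma>\<close>, for which
    \<open>\<sigma> + 1\<close> works over integers and reals alike, and is chosen to cover all
    sampling times so that the inputs agree there.\<close>
  define T where "T = Max ({0, \<sigma> + 1} \<union> set ts)"
  have T: "0 \<le> T" "\<sigma> < T" and tsT: "\<And>t. t \<in> set ts \<Longrightarrow> t \<in> {0..T}"
    using ts Max_ge[of "{0, \<sigma> + 1} \<union> set ts"] unfolding T_def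
    by (auto intro: less_le_trans[of \<sigma> "\<sigma> + 1"])
  have "F *\<^sub>v x' t = F *\<^sub>v x t"
    if x: "Traj u x" and x': "Traj u' x'" and u: "\<forall>s\<in>{0..T}. u' s = u s"
      and y: "\<forall>s\<in>set ts. C *\<^sub>v x' s + D *\<^sub>v u' s = C *\<^sub>v x s + D *\<^sub>v u s"
      and t: "t \<in> {0..T}" for u x u' x' t
  proof -
    define w where "w = R *\<^sub>v (x' 0 - x 0)"
    have c: "x s \<in> carrier_vec n" "x' s \<in> carrier_vec n" if "0 \<le> s" for s
      using car x x' that by auto
    have e: "x' s - x s \<in> carrier_vec n" if "0 \<le> s" for s using c[OF that] by simp
    have w: "w \<in> carrier_vec k" unfolding w_def by (rule mult_mat_vec_carrier[OF R e]) simp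
    have Cc: "C \<in> carrier_mat q n" using C C1 R by simp
    have "w = 0\<^sub>v k"
    proof (rule full_rank_vstack_mult_eq_0[OF rank w])
      fix N assume "N \<in> set (map (\<lambda>t. C1 * \<Phi> t) ts)"
      then obtain s where s: "s \<in> set ts" and N: "N = C1 * \<Phi> s" by auto
      have s0: "0 \<le> s" and sT: "s \<in> {0..T}" using ts[OF s] tsT[OF s] by auto
      have outputs: "C *\<^sub>v x' s + D *\<^sub>v u s = C *\<^sub>v x s + D *\<^sub>v u s" using y s u sT by auto
      have "(C *\<^sub>v x' s) $ i = (C *\<^sub>v x s) $ i" if "i < q" for i
        using arg_cong[OF outputs, of "\<lambda>y. y $ i"] that D by (simp del: index_mult_mat_vec)
      then have "C *\<^sub>v x' s - C *\<^sub>v x s = 0\<^sub>v q"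
        using Cc by (intro eq_vecI) auto
      then have "C *\<^sub>v (x' s - x s) = 0\<^sub>v q"
        using mult_minus_distrib_mat_vec[OF Cc] c[OF s0] by simp
      \<comment> \<open>Since \<open>C\<close> factors through \<open>R\<close>, an output
        difference depends only on the observable part, which is \<open>w\<close> transported by the
        flow.\<close>
      then have "C1 *\<^sub>v (\<Phi> s *\<^sub>v w) = 0\<^sub>v q"
        unfolding w_def diff[OF x x' u sT, symmetric]
        using assoc_mult_mat_vec[OF C1 R e[OF s0]] C by simp
      then show "dim_col N = k \<and> N *\<^sub>v w = 0\<^sub>v (dim_row N)"
        using assoc_mult_mat_vec[OF C1 flow w] carrier_matD[OF flow] C1 N by simp
    qed
    \<comment> \<open>A zero initial value stays zero under the flow, so the conclusion reaches
      every time in the horizon and not only the samples.\<close>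
    then have "R *\<^sub>v (x' t - x t) = \<Phi> t *\<^sub>v 0\<^sub>v k"
      using diff[OF x x' u t] w_def by simp
    also have "\<dots> = 0\<^sub>v k" by (rule mult_mat_vec_zero[OF flow])
    finally have "F *\<^sub>v (x' t - x t) = 0\<^sub>v r" using ker e t by simp
    then have "F *\<^sub>v x' t - F *\<^sub>v x t = 0\<^sub>v r"
      using mult_minus_distrib_mat_vec[OF F] c[of t] t by simp
    then have "(F *\<^sub>v x' t - F *\<^sub>v x t) $ i = 0" if "i < r" for i using that by simp
    then show ?thesis using F by (intro eq_vecI) auto
  qed
  then show ?thesis unfolding sample_based_functionally_observable_def using T by blast
qed

theorem theorem3:
  fixes A B C D F Po Aob A21 Aunob Cob :: "real mat"
    and n m q r p :: nat
  assumes "A \<in> carrier_mat n n" "B \<in> carrier_mat n m"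
    and "C \<in> carrier_mat q n" "D \<in> carrier_mat q m" "F \<in> carrier_mat r n"
    and "p = kernel_dim (obs_mat A C)"
    and "observable_decomposition A C Po Aob A21 Aunob Cob"
  shows
    "(functionally_observable (ct_trajectory A B) C D F \<longrightarrow>
        (\<forall>ts. sampling_scheme ts \<longrightarrow> mat_rank (sampled_obs_mat_ct Aob Cob ts) = n - p \<longrightarrow>
          sample_based_functionally_observable (ct_trajectory A B) C D F 0 ts)) \<and>
     (functionally_observable (dt_trajectory A B) C D F \<longrightarrow>
        (\<forall>PoF AobF A21F AunobF Fob ts.
          observable_decomposition A F PoF AobF A21F AunobF Fob \<longrightarrow>
          sampling_scheme ts \<longrightarrow> mat_rank (sampled_obs_mat_dt Aob Cob ts) = n - p \<longrightarrow>
          sample_based_functionally_observable (dt_trajectory A B) C D F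
            (int (observability_index AobF Fob) - 2) ts))"
proof (intro conjI impI allI)
  note A = assms(1) and B = assms(2) and C = assms(3) and D = assms(4) and F = assms(5)
  obtain n1 n2 R S where n1: "n1 = n - p"
    and Aob: "Aob \<in> carrier_mat n1 n1" and Aunob: "Aunob \<in> carrier_mat n2 n2"
    and Cob: "Cob \<in> carrier_mat q n1" and R: "R \<in> carrier_mat n1 n" and S: "S \<in> carrier_mat n n2"
    and RA: "R * A = Aob * R" and CR: "C = Cob * R" and AS: "A * S = S * Aunob"
    and CS: "C * S = 0\<^sub>m q n2"
    and ker: "\<And>v. v \<in> carrier_vec n \<Longrightarrow> R *\<^sub>v v = 0\<^sub>v n1 \<Longrightarrow> \<exists>z\<in>carrier_vec n2. v = S *\<^sub>v z"
    using observable_decompositionE[OF A C assms(7)] unfolding assms(6) by metis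
  \<comment> \<open>States in the range of \<open>S\<close> contribute nothing to the output; this
    makes the lifted trajectories indistinguishable from zero.\<close>
  have CS0: "C *\<^sub>v (S *\<^sub>v z) = 0\<^sub>v q" if "z \<in> carrier_vec n2" for z
    unfolding assoc_mult_mat_vec[OF C S that, symmetric] CS using that by (auto intro!: eq_vecI)
  {
    fix ts :: "real list"
    assume fo: "functionally_observable (ct_trajectory A B) C D F"
      and ts: "sampling_scheme ts" and rank: "mat_rank (sampled_obs_mat_ct Aob Cob ts) = n - p"
    have E: "mat_exp (t \<cdot>\<^sub>m Aunob) \<in> carrier_mat n2 n2" for t using Aunob by simp
    have FS: "F *\<^sub>v (S *\<^sub>v z) = 0\<^sub>v r" if "z \<in> carrier_vec n2" for z
    proof (rule functionally_observable_embed[OF fo F S ct_trajectory_embed[OF A B S Aunob AS]])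
      show "C *\<^sub>v (S *\<^sub>v (mat_exp (t \<cdot>\<^sub>m Aunob) *\<^sub>v z)) = 0\<^sub>v q" if "z \<in> carrier_vec n2" for z t
        by (rule CS0[OF mult_mat_vec_carrier[OF E that]])
    qed (use that Aunob in \<open>auto simp: mat_exp_0\<close>)
    show "sample_based_functionally_observable (ct_trajectory A B) C D F 0 ts"
    proof (rule sample_based_functionally_observableI[OF CR Cob R D F])
      show "mat_rank (vstack n1 (map (\<lambda>t. Cob * mat_exp (t \<cdot>\<^sub>m Aob)) ts)) = n1"
        using rank Aob n1 by (simp add: sampled_obs_mat_ct_def)
      \<comment> \<open>A vector annihilated by \<open>R\<close> lies in the range of
        \<open>S\<close>, where functional observability has made \<open>F\<close> vanish.\<close>
      show "F *\<^sub>v v = 0\<^sub>v r" if "v \<in> carrier_vec n" "R *\<^sub>v v = 0\<^sub>v n1" for v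
        using ker[OF that] FS by auto
      show "0 \<le> t" if "t \<in> set ts" for t using ts that by (simp add: sampling_scheme_def)
      show "x t \<in> carrier_vec n" if "ct_trajectory A B u x" "0 \<le> t" for u x t
        using that A by (simp add: ct_trajectory_def)
      show "mat_exp (t \<cdot>\<^sub>m Aob) \<in> carrier_mat n1 n1" for t using Aob by simp
    qed (rule ct_trajectory_diff_eq[OF A B R Aob RA])
  next
    fix PoF AobF A21F AunobF Fob and ts :: "int list"
    assume fo: "functionally_observable (dt_trajectory A B) C D F"
      and ts: "sampling_scheme ts" and rank: "mat_rank (sampled_obs_mat_dt Aob Cob ts) = n - p"
    have FS: "F *\<^sub>v (S *\<^sub>v z) = 0\<^sub>v r" if "z \<in> carrier_vec n2" for z
    proof (rule functionally_observable_embed[OF fo F S dt_trajectory_embed[OF A B S Aunob AS]])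
      show "C *\<^sub>v (S *\<^sub>v (Aunob ^\<^sub>m nat t *\<^sub>v z)) = 0\<^sub>v q" if "z \<in> carrier_vec n2" for z t
        by (rule CS0[OF mult_mat_vec_carrier[OF pow_carrier_mat[OF Aunob] that]])
    qed (use that Aunob in auto)
    show "sample_based_functionally_observable (dt_trajectory A B) C D F
        (int (observability_index AobF Fob) - 2) ts"
    proof (rule sample_based_functionally_observableI[OF CR Cob R D F])
      show "mat_rank (vstack n1 (map (\<lambda>t. Cob * Aob ^\<^sub>m nat t) ts)) = n1"
        using rank Aob n1 by (simp add: sampled_obs_mat_dt_def)
      show "F *\<^sub>v v = 0\<^sub>v r" if "v \<in> carrier_vec n" "R *\<^sub>v v = 0\<^sub>v n1" for v
        using ker[OF that] FS by auto
      show "0 \<le> t" if "t \<in> set ts" for t using ts that by (simp add: sampling_scheme_def)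
      show "x t \<in> carrier_vec n" if "dt_trajectory A B u x" "0 \<le> t" for u x t
        using that A by (simp add: dt_trajectory_def)
      show "Aob ^\<^sub>m nat t \<in> carrier_mat n1 n1" for t using Aob by simp
    qed (rule dt_trajectory_diff_eq[OF A B R Aob RA])
  }
qed

end
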